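(* Let $U,V$ be $c$-terms. If $U\triangleright V$, then $\psi(U)\to^+\psi(V)$.
   Context: **Types.** There are two sets of base types $\mathcal{A} = \{a,b,\dots\}$ and $\mathcal{A}^{\perp} = \{a^{\perp},b^{\perp},\dots\}$. The $m$-types are generated by $A ::= a \mid a^{\perp} \mid A\wedge A \mid A\vee A$ ($a\in\mathcal{A}$). A type is either an $m$-type or the constant $\perp$. Negation of $m$-types: $(a)^{\perp}=a^{\perp}$, $(a^{\perp})^{\perp}=a$, $(A\wedge B)^{\perp}=A^{\perp}\vee B^{\perp}$, $(A\vee B)^{\perp}=A^{\perp}\wedge B^{\perp}$. Below $\Gamma$ is a set of declarations assigning $m$-types to variables and, in the rules, $A,B,C$ range over $m$-types. **System $\lambda^{Sym}_{Prop}$.** The $\lambda_s$-terms are the expressions (up to renaming of bound variables) typable by: - $\Gamma, x:A\vdash x:A$; - from $\Gamma\vdash u:A$ and $\Gamma\vdash v:B$ infer $\Gamma\vdash \langle u,v\rangle : A\wedge B$; - from $\Gamma\vdash t:A$ infer $\Gamma\vdash\sigma_1(t):A\vee B$; - from $\Gamma\vdash t:B$ infer $\Gamma\vdash\sigma_2(t):A\vee B$; - from $\Gamma,x:A\vdash t:\perp$ infer $\Gamma\vdash\lambda x.t:A^{\perp}$; - from $\Gamma\vdash u:A^{\perp}$ and $\Gamma\vdash v:A$ infer $\Gamma\vdash u\star v:\perp$. $Fv$ denotes the set of free variables, and substitution is capture-avoiding. One-step reduction $\to$ is application to a subterm of one of the rules: - $(\lambda x.u)\star v\to u[x:=v]$;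 - $v\star(\lambda x.u)\to u[x:=v]$; - $\lambda x.(u\star x)\to u$ if $x\notin Fv(u)$; - $\lambda x.(x\star u)\to u$ if $x\notin Fv(u)$; - $\langle u,v\rangle\star\sigma_1(w)\to u\star w$; - $\langle u,v\rangle\star\sigma_2(w)\to v\star w$; - $\sigma_1(w)\star\langle u,v\rangle\to w\star u$; - $\sigma_2(w)\star\langle u,v\rangle\to w\star v$; - (triv) $u[x:=v]\to v$ if $u$ and $v$ are terms of type $\perp$, $x$ occurs exactly once in $u$ and $u\neq x$ (here $x$ is a placeholder of type $\perp$; then $v=v_1\star v_2$ and $\lambda y.x$ is a subterm of $u$ for some $y$). $\to^+$ is the transitive closure of $\to$. **System CCL.** The $c$-terms are the expressions built from variables and the constants $\mathbf{K},\mathbf{S},\mathbf{C},\mathbf{P},\mathbf{Q_1},\mathbf{Q_2}$ that are typable by: - $\Gamma,x:A\vdash x:A$; - $\Gamma\vdash\mathbf{K}:A^{\perp}\vee(B\vee A)$; - $\Gamma\vdash\mathbf{S}:(A\wedge(B\wedge C^{\perp}))\vee((A\wedge B^{\perp})\vee(A^{\perp}\vee C))$; - $\Gamma\vdash\mathbf{C}:(A\wedge B)\vee((A\wedge B^{\perp})\vee A^{\perp})$; - $\Gamma\vdash\mathbf{P}:A^{\perp}\vee(B^{\perp}\vee(A\wedge B))$; - $\Gamma\vdash\mathbf{Q_1}:A^{\perp}\vee(A\vee B)$; - $\Gamma\vdash\mathbf{Q_2}:B^{\perp}\vee(A\vee B)$; - from $\Gamma\vdash U:A^{\perp}\vee B$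 and $\Gamma\vdash V:A$ infer $\Gamma\vdash(U\;V):B$; - from $\Gamma\vdash U:A^{\perp}$ and $\Gamma\vdash V:A$ infer $\Gamma\vdash U\star V:\perp$. Each axiom holds for all instances of $A,B,C$. $(U\;U_1\dots U_n)$ means $(\dots((U\;U_1)\;U_2)\dots U_n)$, and $\mathbf{I}=(\mathbf{S}\;\mathbf{K}\;\mathbf{K})$. One-step reduction $\triangleright$ is application to a subterm of one of the rules: - $(\mathbf{K}\;U\;V)\triangleright U$; - $(\mathbf{S}\;U\;V\;W)\triangleright((U\;W)\;(V\;W))$; - $(\mathbf{C}\;U\;V)\star W\triangleright(U\;W)\star(V\;W)$; - $W\star(\mathbf{C}\;U\;V)\triangleright(U\;W)\star(V\;W)$; - $(\mathbf{C}\;(\mathbf{K}\;U)\;\mathbf{I})\triangleright U$; - $(\mathbf{C}\;\mathbf{I}\;(\mathbf{K}\;U))\triangleright U$; - $(\mathbf{P}\;U\;V)\star(\mathbf{Q_1}\;W)\triangleright U\star W$; - $(\mathbf{P}\;U\;V)\star(\mathbf{Q_2}\;W)\triangleright V\star W$; - $(\mathbf{Q_1}\;W)\star(\mathbf{P}\;U\;V)\triangleright W\star U$; - $(\mathbf{Q_2}\;W)\star(\mathbf{P}\;U\;V)\triangleright W\star V$; - (simp) $W[x:=(\mathbf{C}\;(\mathbf{K}\;U)\;(\mathbf{K}\;V))]\triangleright U\star V$ if $W$ is a $c$-term of type $\perp$ in which $x$ occurs. **Notation.** For $i\in\{1,2\}$, $\pi_it$ denotes $\lambda x.(t\star\sigma_i(x))$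 with $x\notin Fv(t)$; $\pi_{i_1\dots i_n}t$ denotes $\pi_{i_1}\cdots\pi_{i_n}t$ (so $\pi_{12}t=\pi_1(\pi_2t)$). $[u,v]$ denotes $\lambda x.(u\star\langle v,x\rangle)$ with $x\notin Fv(u)\cup Fv(v)$. **Encoding $\psi$ of $c$-terms into $\lambda_s$-terms.** - $\psi(x)=x$; - $\psi(\mathbf{K})=\lambda x.(\pi_1x\star\pi_{22}x)$; - $\psi(\mathbf{S})=\lambda x.([[\pi_1x,\pi_{122}x],[\pi_{12}x,\pi_{122}x]]\star\pi_{222}x)$; - $\psi(\mathbf{C})=\lambda x.([\pi_1x,\pi_{22}x]\star[\pi_{12}x,\pi_{22}x])$; - $\psi(\mathbf{P})=\lambda x.(\langle\pi_1x,\pi_{12}x\rangle\star\pi_{22}x)$; - $\psi(\mathbf{Q_1})=\lambda x.(\sigma_1(\pi_1x)\star\pi_2x)$; - $\psi(\mathbf{Q_2})=\lambda x.(\sigma_2(\pi_1x)\star\pi_2x)$; - $\psi((U\;V))=[\psi(U),\psi(V)]$; - $\psi(U\star V)=\psi(U)\star\psi(V)$. *)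

theory Defs
  imports Main
begin

text \<open>The atoms range over an arbitrary type \<open>'a\<close>. Terms carry no type annotations, so notions
  that refer to typability of a bare term take the type of atoms as an argument \<open>TYPE('a)\<close>.\<close>

datatype 'a mty =
    Atom 'a
  | NegAtom 'a
  | Conj "'a mty" "'a mty"
  | Disj "'a mty" "'a mty"

datatype 'a ty = MType "'a mty" | Bot

primrec neg :: "'a mty \<Rightarrow> 'a mty" where
  "neg (Atom a) = NegAtom a"
| "neg (NegAtom a) = Atom a"
| "neg (Conj A B) = Disj (neg A) (neg B)"
| "neg (Disj A B) = Conj (neg A) (neg B)"

text \<open>Expressions up to renaming of bound variables, represented with de Bruijn indices.\<close>

datatype lexp =
    Var nat
  | Pair lexp lexp
  | Inj1 lexp
  | Inj2 lexp
  | Lam lexp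
  | Star lexp lexp

primrec lift :: "lexp \<Rightarrow> nat \<Rightarrow> lexp" where
  "lift (Var i) k = (if i < k then Var i else Var (Suc i))"
| "lift (Pair u v) k = Pair (lift u k) (lift v k)"
| "lift (Inj1 t) k = Inj1 (lift t k)"
| "lift (Inj2 t) k = Inj2 (lift t k)"
| "lift (Lam t) k = Lam (lift t (Suc k))"
| "lift (Star u v) k = Star (lift u k) (lift v k)"

text \<open>\<open>subst t s k\<close> replaces index \<open>k\<close> of \<open>t\<close> by \<open>s\<close> and removes \<open>k\<close> from the scope, i.e. the
  indices above \<open>k\<close> are decremented.\<close>

primrec subst :: "lexp \<Rightarrow> lexp \<Rightarrow> nat \<Rightarrow> lexp" where
  "subst (Var i) s k = (if k < i then Var (i - 1) else if i = k then s else Var i)"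
| "subst (Pair u v) s k = Pair (subst u s k) (subst v s k)"
| "subst (Inj1 t) s k = Inj1 (subst t s k)"
| "subst (Inj2 t) s k = Inj2 (subst t s k)"
| "subst (Lam t) s k = Lam (subst t (lift s 0) (Suc k))"
| "subst (Star u v) s k = Star (subst u s k) (subst v s k)"

primrec occ :: "nat \<Rightarrow> lexp \<Rightarrow> nat" where
  "occ k (Var i) = (if i = k then 1 else 0)"
| "occ k (Pair u v) = occ k u + occ k v"
| "occ k (Inj1 t) = occ k t"
| "occ k (Inj2 t) = occ k t"
| "occ k (Lam t) = occ (Suc k) t"
| "occ k (Star u v) = occ k u + occ k v"

text \<open>Environments may declare variables of type \<open>Bot\<close>; this is used only for the placeholder of
  the rule \<open>triv\<close> below. The declarations \<open>\<Gamma>\<close> of the calculus itself are those satisfying \<open>menv\<close>.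
  \<open>case_nat (Some T) G\<close> is \<open>G\<close> extended by a declaration of index 0.\<close>

inductive ltyping :: "(nat \<rightharpoonup> 'a ty) \<Rightarrow> lexp \<Rightarrow> 'a ty \<Rightarrow> bool" where
  lt_var: "G i = Some T \<Longrightarrow> ltyping G (Var i) T"
| lt_pair: "ltyping G u (MType A) \<Longrightarrow> ltyping G v (MType B)
    \<Longrightarrow> ltyping G (Pair u v) (MType (Conj A B))"
| lt_inj1: "ltyping G t (MType A) \<Longrightarrow> ltyping G (Inj1 t) (MType (Disj A B))"
| lt_inj2: "ltyping G t (MType B) \<Longrightarrow> ltyping G (Inj2 t) (MType (Disj A B))"
| lt_lam: "ltyping (case_nat (Some (MType A)) G) t Bot \<Longrightarrow> ltyping G (Lam t) (MType (neg A))"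
| lt_star: "ltyping G u (MType (neg A)) \<Longrightarrow> ltyping G v (MType A) \<Longrightarrow> ltyping G (Star u v) Bot"

definition menv :: "(nat \<rightharpoonup> 'a ty) \<Rightarrow> bool" where
  "menv G \<longleftrightarrow> ran G \<subseteq> range MType"

definition lterm :: "'a itself \<Rightarrow> lexp \<Rightarrow> bool" where
  "lterm _ t \<longleftrightarrow> (\<exists>(G :: nat \<rightharpoonup> 'a ty) T. menv G \<and> ltyping G t T)"

text \<open>A term of the form \<open>lift u 0\<close> is one in which the variable bound by the enclosing \<open>Lam\<close>
  does not occur free.\<close>

inductive lstep :: "'a itself \<Rightarrow> lexp \<Rightarrow> lexp \<Rightarrow> bool" for ty :: "'a itself" where
  beta: "lstep ty (Star (Lam u) v) (subst u v 0)"
| beta_sym: "lstep ty (Star v (Lam u)) (subst u v 0)"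
| eta: "lstep ty (Lam (Star (lift u 0) (Var 0))) u"
| eta_sym: "lstep ty (Lam (Star (Var 0) (lift u 0))) u"
| pair_inj1: "lstep ty (Star (Pair u v) (Inj1 w)) (Star u w)"
| pair_inj2: "lstep ty (Star (Pair u v) (Inj2 w)) (Star v w)"
| inj1_pair: "lstep ty (Star (Inj1 w) (Pair u v)) (Star w u)"
| inj2_pair: "lstep ty (Star (Inj2 w) (Pair u v)) (Star w v)"
| triv: "menv (G :: nat \<rightharpoonup> 'a ty) \<Longrightarrow> ltyping (case_nat (Some Bot) G) u Bot \<Longrightarrow> ltyping G v Bot
    \<Longrightarrow> occ 0 u = 1 \<Longrightarrow> u \<noteq> Var 0 \<Longrightarrow> lstep ty (subst u v 0) v"
| ctx_pair1: "lstep ty u u' \<Longrightarrow> lstep ty (Pair u v) (Pair u' v)"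
| ctx_pair2: "lstep ty v v' \<Longrightarrow> lstep ty (Pair u v) (Pair u v')"
| ctx_inj1: "lstep ty t t' \<Longrightarrow> lstep ty (Inj1 t) (Inj1 t')"
| ctx_inj2: "lstep ty t t' \<Longrightarrow> lstep ty (Inj2 t) (Inj2 t')"
| ctx_lam: "lstep ty t t' \<Longrightarrow> lstep ty (Lam t) (Lam t')"
| ctx_star1: "lstep ty u u' \<Longrightarrow> lstep ty (Star u v) (Star u' v)"
| ctx_star2: "lstep ty v v' \<Longrightarrow> lstep ty (Star u v) (Star u v')"

text \<open>Reduction is a relation between typable terms.\<close>

definition lred :: "'a itself \<Rightarrow> lexp \<Rightarrow> lexp \<Rightarrow> bool" where
  "lred ty t t' \<longleftrightarrow> lterm ty t \<and> lterm ty t' \<and> lstep ty t t'"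

datatype cexp =
    CVar nat
  | CK | CS | CC | CP | CQ1 | CQ2
  | CApp cexp cexp
  | CStar cexp cexp

definition CI :: cexp where
  "CI = CApp (CApp CS CK) CK"

primrec cvars :: "cexp \<Rightarrow> nat set" where
  "cvars (CVar x) = {x}"
| "cvars CK = {}"
| "cvars CS = {}"
| "cvars CC = {}"
| "cvars CP = {}"
| "cvars CQ1 = {}"
| "cvars CQ2 = {}"
| "cvars (CApp U V) = cvars U \<union> cvars V"
| "cvars (CStar U V) = cvars U \<union> cvars V"

primrec csubst :: "cexp \<Rightarrow> nat \<Rightarrow> cexp \<Rightarrow> cexp" where
  "csubst (CVar y) x Z = (if y = x then Z else CVar y)"
| "csubst CK x Z = CK"
| "csubst CS x Z = CS"
| "csubst CC x Z = CC"
| "csubst CP x Z = CP"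
| "csubst CQ1 x Z = CQ1"
| "csubst CQ2 x Z = CQ2"
| "csubst (CApp U V) x Z = CApp (csubst U x Z) (csubst V x Z)"
| "csubst (CStar U V) x Z = CStar (csubst U x Z) (csubst V x Z)"

inductive ctyping :: "(nat \<rightharpoonup> 'a mty) \<Rightarrow> cexp \<Rightarrow> 'a ty \<Rightarrow> bool" where
  ct_var: "G x = Some A \<Longrightarrow> ctyping G (CVar x) (MType A)"
| ct_K: "ctyping G CK (MType (Disj (neg A) (Disj B A)))"
| ct_S: "ctyping G CS (MType (Disj (Conj A (Conj B (neg C)))
    (Disj (Conj A (neg B)) (Disj (neg A) C))))"
| ct_C: "ctyping G CC (MType (Disj (Conj A B) (Disj (Conj A (neg B)) (neg A))))"
| ct_P: "ctyping G CP (MType (Disj (neg A) (Disj (neg B) (Conj A B))))"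
| ct_Q1: "ctyping G CQ1 (MType (Disj (neg A) (Disj A B)))"
| ct_Q2: "ctyping G CQ2 (MType (Disj (neg B) (Disj A B)))"
| ct_app: "ctyping G U (MType (Disj (neg A) B)) \<Longrightarrow> ctyping G V (MType A)
    \<Longrightarrow> ctyping G (CApp U V) (MType B)"
| ct_star: "ctyping G U (MType (neg A)) \<Longrightarrow> ctyping G V (MType A) \<Longrightarrow> ctyping G (CStar U V) Bot"

definition cterm :: "'a itself \<Rightarrow> cexp \<Rightarrow> bool" where
  "cterm _ U \<longleftrightarrow> (\<exists>(G :: nat \<rightharpoonup> 'a mty) T. ctyping G U T)"

inductive cstep :: "'a itself \<Rightarrow> cexp \<Rightarrow> cexp \<Rightarrow> bool" for ty :: "'a itself" where
  cs_K: "cstep ty (CApp (CApp CK U) V) U"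
| cs_S: "cstep ty (CApp (CApp (CApp CS U) V) W) (CApp (CApp U W) (CApp V W))"
| cs_C: "cstep ty (CStar (CApp (CApp CC U) V) W) (CStar (CApp U W) (CApp V W))"
| cs_C_sym: "cstep ty (CStar W (CApp (CApp CC U) V)) (CStar (CApp U W) (CApp V W))"
| cs_eta: "cstep ty (CApp (CApp CC (CApp CK U)) CI) U"
| cs_eta_sym: "cstep ty (CApp (CApp CC CI) (CApp CK U)) U"
| cs_P_Q1: "cstep ty (CStar (CApp (CApp CP U) V) (CApp CQ1 W)) (CStar U W)"
| cs_P_Q2: "cstep ty (CStar (CApp (CApp CP U) V) (CApp CQ2 W)) (CStar V W)"
| cs_Q1_P: "cstep ty (CStar (CApp CQ1 W) (CApp (CApp CP U) V)) (CStar W U)"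
| cs_Q2_P: "cstep ty (CStar (CApp CQ2 W) (CApp (CApp CP U) V)) (CStar W V)"
| cs_simp: "ctyping (G :: nat \<rightharpoonup> 'a mty) W Bot \<Longrightarrow> x \<in> cvars W
    \<Longrightarrow> cstep ty (csubst W x (CApp (CApp CC (CApp CK U)) (CApp CK V))) (CStar U V)"
| cs_app1: "cstep ty U U' \<Longrightarrow> cstep ty (CApp U V) (CApp U' V)"
| cs_app2: "cstep ty V V' \<Longrightarrow> cstep ty (CApp U V) (CApp U V')"
| cs_star1: "cstep ty U U' \<Longrightarrow> cstep ty (CStar U V) (CStar U' V)"
| cs_star2: "cstep ty V V' \<Longrightarrow> cstep ty (CStar U V) (CStar U V')"

definition cred :: "'a itself \<Rightarrow> cexp \<Rightarrow> cexp \<Rightarrow> bool" where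
  "cred ty U V \<longleftrightarrow> cterm ty U \<and> cterm ty V \<and> cstep ty U V"

definition proj1 :: "lexp \<Rightarrow> lexp" where
  "proj1 t = Lam (Star (lift t 0) (Inj1 (Var 0)))"

definition proj2 :: "lexp \<Rightarrow> lexp" where
  "proj2 t = Lam (Star (lift t 0) (Inj2 (Var 0)))"

definition app :: "lexp \<Rightarrow> lexp \<Rightarrow> lexp" where
  "app u v = Lam (Star (lift u 0) (Pair (lift v 0) (Var 0)))"

text \<open>In the clauses for the constants, \<open>Var 0\<close> is the variable bound by the outermost \<open>Lam\<close>.\<close>

primrec psi :: "cexp \<Rightarrow> lexp" where
  "psi (CVar x) = Var x"
| "psi CK = Lam (Star (proj1 (Var 0)) (proj2 (proj2 (Var 0))))"
| "psi CS = Lam (Star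
    (app (app (proj1 (Var 0)) (proj1 (proj2 (proj2 (Var 0)))))
         (app (proj1 (proj2 (Var 0))) (proj1 (proj2 (proj2 (Var 0))))))
    (proj2 (proj2 (proj2 (Var 0)))))"
| "psi CC = Lam (Star
    (app (proj1 (Var 0)) (proj2 (proj2 (Var 0))))
    (app (proj1 (proj2 (Var 0))) (proj2 (proj2 (Var 0)))))"
| "psi CP = Lam (Star (Pair (proj1 (Var 0)) (proj1 (proj2 (Var 0)))) (proj2 (proj2 (Var 0))))"
| "psi CQ1 = Lam (Star (Inj1 (proj1 (Var 0))) (proj2 (Var 0)))"
| "psi CQ2 = Lam (Star (Inj2 (proj1 (Var 0))) (proj2 (Var 0)))"
| "psi (CApp U V) = app (psi U) (psi V)"
| "psi (CStar U V) = Star (psi U) (psi V)"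

end

theory Submission imports Defs
begin

text \<open>Read a type \<open>neg A\<close> as the type of refutations of \<open>A\<close>, and \<open>Star u v\<close> as the interaction of a
  term with an opposing one. The term \<open>app u v\<close> interacts with \<open>w\<close> by letting \<open>u\<close> interact with
  \<open>Pair v w\<close>, so a combinator applied to several arguments finds these arguments stacked up in
  nested pairs. The encoding of each constant is an abstraction over such a stack, whose body takes
  the stack apart by projections and puts it together again as the contractum prescribes
  (\<open>K_stack\<close>, \<open>S_stack\<close>, \<open>C_stack\<close>, \<open>P_stack\<close>, \<open>Q1_stack\<close>, \<open>Q2_stack\<close>). As projections of pairs
  compute by the logical rules and \<open>eta\<close>, the combinatory rules other than \<open>simp\<close> are simulated
  without regard to types; where the contractum is no longer an interaction, a final \<open>eta\<close>
  discards the abstraction that supplied the bottom of the stack.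

  The rule \<open>simp\<close> erases a whole context \<open>W\<close>. The encoding of \<open>C (K U) (K V)\<close> reduces to the vacuous
  abstraction of \<open>Star (psi U) (psi V)\<close> (\<open>vacuous_abs\<close>). Although \<open>W\<close> may contain many copies of
  the redex, it suffices to reduce one of them in this way: the surroundings of its body,
  the other copies included, then form a context with exactly one placeholder of type \<open>Bot\<close>
  (\<open>isolate_copy\<close>), which \<open>triv\<close> erases at once.

  Finally, reduction relates typable terms. The encoding preserves typing (\<open>psi_typing\<close>) and so does
  every reduction step (\<open>subject_reduction\<close>), so all terms passed through are typable.\<close>

section \<open>Lifting and substitution\<close>

lemma lift_lift:
  "i \<le> k \<Longrightarrow> lift (lift t i) (Suc k) = lift (lift t k) i"
  by (induction t arbitrary: i k) auto

lemma subst_lift [simp]: "subst (lift t k) s k = t"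
  by (induction t arbitrary: s k) auto

lemma lift_subst_le:
  "j \<le> k \<Longrightarrow> lift (subst t s j) k = subst (lift t (Suc k)) (lift s k) j"
  by (induction t arbitrary: s j k) (auto simp: lift_lift)

lemma subst_lift_le:
  "k \<le> j \<Longrightarrow> subst (lift t k) (lift s k) (Suc j) = lift (subst t s j) k"
proof (induction t arbitrary: s j k)
  case (Lam t)
  have "lift (lift s k) 0 = lift (lift s 0) (Suc k)"
    by (simp add: lift_lift)
  with Lam show ?case by simp
qed auto

lemma occ_lift_same [simp]: "occ k (lift t k) = 0"
  by (induction t arbitrary: k) auto

lemma occ_lift_less: "j < k \<Longrightarrow> occ j (lift t k) = occ j t"
  by (induction t arbitrary: j k) auto

lemma occ_lift_ge: "k \<le> j \<Longrightarrow> occ (Suc j) (lift t k) = occ j t"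
  by (induction t arbitrary: j k) auto

lemma lift_eq_Var_0 [simp]: "lift t (Suc k) = Var 0 \<longleftrightarrow> t = Var 0"
  by (cases t) auto

lemma app_neq_Var [simp]: "app u v \<noteq> Var i"
  by (simp add: app_def)

lemma lift_proj1 [simp]: "lift (proj1 t) k = proj1 (lift t k)"
  by (simp add: proj1_def lift_lift)

lemma lift_proj2 [simp]: "lift (proj2 t) k = proj2 (lift t k)"
  by (simp add: proj2_def lift_lift)

lemma lift_app [simp]: "lift (app u v) k = app (lift u k) (lift v k)"
  by (simp add: app_def lift_lift)

lemma subst_proj1 [simp]: "subst (proj1 t) s k = proj1 (subst t s k)"
  by (simp add: proj1_def subst_lift_le)

lemma subst_proj2 [simp]: "subst (proj2 t) s k = proj2 (subst t s k)"
  by (simp add: proj2_def subst_lift_le)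

lemma subst_app [simp]: "subst (app u v) s k = app (subst u s k) (subst v s k)"
  by (simp add: app_def subst_lift_le)

lemma occ_app [simp]: "occ k (app u v) = occ k u + occ k v"
  by (simp add: app_def occ_lift_ge)

section \<open>Typing\<close>

lemma neg_neg [simp]: "neg (neg A) = A"
  by (induction A) auto

lemma neg_eq_iff [simp]: "neg A = neg B \<longleftrightarrow> A = B"
  by (metis neg_neg)

lemma neg_eq_Conj_iff: "neg A = Conj B C \<longleftrightarrow> A = Disj (neg B) (neg C)"
  by (metis neg.simps(4) neg_neg)

lemma neg_eq_Disj_iff: "neg A = Disj B C \<longleftrightarrow> A = Conj (neg B) (neg C)"
  by (metis neg.simps(3) neg_neg)

inductive_cases lt_VarE [elim!]: "ltyping G (Var i) T"
inductive_cases lt_PairE [elim!]: "ltyping G (Pair u v) T"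
inductive_cases lt_Inj1E [elim!]: "ltyping G (Inj1 t) T"
inductive_cases lt_Inj2E [elim!]: "ltyping G (Inj2 t) T"
inductive_cases lt_LamE [elim!]: "ltyping G (Lam t) T"
inductive_cases lt_StarE [elim!]: "ltyping G (Star u v) T"

text \<open>The typing rules for \<open>Lam\<close> and \<open>Star\<close> mention \<open>neg A\<close>, which is a pattern that no concrete type
  matches syntactically. As \<open>neg\<close> is an involution, the negation can be moved to the other
  component.\<close>

lemma lt_lam_neg:
  "ltyping (case_nat (Some (MType (neg A))) G) t Bot \<Longrightarrow> ltyping G (Lam t) (MType A)"
  using lt_lam[of "neg A" G t] by simp

lemma lt_star_neg:
  "ltyping G u (MType A) \<Longrightarrow> ltyping G v (MType (neg A)) \<Longrightarrow> ltyping G (Star u v) Bot"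
  using lt_star[of G u "neg A" v] by simp

definition insert_env :: "nat \<Rightarrow> 'b option \<Rightarrow> (nat \<rightharpoonup> 'b) \<Rightarrow> nat \<rightharpoonup> 'b" where
  "insert_env k X G = (\<lambda>i. if i < k then G i else if i = k then X else G (i - 1))"

lemma case_nat_eq_insert_env: "case_nat X G = insert_env 0 X G"
  by (auto simp: insert_env_def fun_eq_iff split: nat.split)

lemma case_nat_insert_env [simp]:
  "case_nat Y (insert_env k X G) = insert_env (Suc k) X (case_nat Y G)"
  by (auto simp: insert_env_def fun_eq_iff split: nat.split)

lemma menv_insert_None: "menv G \<Longrightarrow> menv (insert_env k None G)"
  by (auto simp: menv_def insert_env_def ran_def split: if_splits)

text \<open>The direction from left to right is strengthening. It gives subject reduction for the two \<open>eta\<close>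
  rules and brings terms back out of a vacuous abstraction.\<close>

lemma ltyping_lift_insert_env [simp]:
  "ltyping (insert_env k X G) (lift t k) T \<longleftrightarrow> ltyping G t T"
proof (induction t arbitrary: k G T)
  case (Var i)
  show ?case
    by (auto simp: insert_env_def intro!: lt_var split: if_splits)
next
  case (Pair u v)
  then show ?case by (auto intro!: lt_pair)
next
  case (Inj1 t)
  then show ?case by (auto intro!: lt_inj1)
next
  case (Inj2 t)
  then show ?case by (auto intro!: lt_inj2)
next
  case (Lam t)
  then show ?case by (auto intro!: lt_lam)
next
  case (Star u v)
  then show ?case by (auto intro: lt_star)
qed

lemma ltyping_lift_case_nat [simp]:
  "ltyping (case_nat X G) (lift t 0) T \<longleftrightarrow> ltyping G t T"
  by (simp add: case_nat_eq_insert_env)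

lemma ltyping_subst:
  assumes "ltyping (insert_env k (Some S) G) t T" "ltyping G s S"
  shows "ltyping G (subst t s k) T"
  using assms
proof (induction t arbitrary: k G T s)
  case (Var i)
  then show ?case
    by (auto simp: insert_env_def intro!: lt_var split: if_splits)
next
  case (Pair u v)
  then show ?case by (auto intro!: lt_pair)
next
  case (Inj1 t)
  then show ?case by (auto intro!: lt_inj1)
next
  case (Inj2 t)
  then show ?case by (auto intro!: lt_inj2)
next
  case (Lam t)
  then show ?case by (auto intro!: lt_lam)
next
  case (Star u v)
  then show ?case by (fastforce intro: lt_star)
qed

lemma ltyping_subst_0:
  "ltyping (case_nat (Some S) G) t T \<Longrightarrow> ltyping G s S \<Longrightarrow> ltyping G (subst t s 0) T"
  by (simp add: case_nat_eq_insert_env ltyping_subst)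

text \<open>A substituted term that does occur is a subterm of the result, up to lifting.\<close>

lemma ltyping_substituted:
  assumes "ltyping G (subst u v k) T" "occ k u \<noteq> 0"
  shows "\<exists>T'. ltyping G v T'"
  using assms
proof (induction u arbitrary: G v k T)
  case (Lam u)
  then show ?case by fastforce
qed (auto split: if_splits)

lemma Bot_typed_is_Star:
  assumes "ltyping G v Bot" "menv G"
  obtains v1 v2 where "v = Star v1 v2"
  using assms by cases (auto simp: menv_def ran_def)

text \<open>For \<open>triv\<close>, the typings of the redex recorded in the rule live in an environment unrelated to
  the given one. They only serve to see that both sides are of the form \<open>Star\<close>, hence can have no
  type other than \<open>Bot\<close>; the typing of \<open>v\<close> in the given environment comes from its occurrence in
  the redex.\<close>

theorem subject_reduction:
  assumes "lstep ty t t'" "ltyping G t T"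
  shows "ltyping G t' T"
  using assms
proof (induction arbitrary: G T rule: lstep.induct)
  case (beta u v)
  then show ?case by (auto intro: ltyping_subst_0)
next
  case (beta_sym v u)
  then show ?case by (auto intro: ltyping_subst_0)
next
  case (eta u)
  then show ?case by auto
next
  case (eta_sym u)
  then show ?case by auto
next
  case (pair_inj1 u v w)
  then show ?case by (auto simp: neg_eq_Conj_iff intro: lt_star)
next
  case (pair_inj2 u v w)
  then show ?case by (auto simp: neg_eq_Conj_iff intro: lt_star)
next
  case (inj1_pair w u v)
  then show ?case by (auto simp: neg_eq_Disj_iff intro: lt_star)
next
  case (inj2_pair w u v)
  then show ?case by (auto simp: neg_eq_Disj_iff intro: lt_star)
next
  case (triv G' u v)
  obtain v1 v2 where v: "v = Star v1 v2"
    using triv.hyps Bot_typed_is_Star by blast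
  have "\<exists>u1 u2. u = Star u1 u2"
    using triv.hyps(2)
  proof cases
    case (lt_var i)
    with triv.hyps(1,5) show ?thesis
      by (auto simp: menv_def ran_def split: nat.splits)
  qed auto
  then have "T = Bot" using triv.prems by auto
  moreover obtain T' where T': "ltyping G v T'"
    using ltyping_substituted[OF triv.prems] triv.hyps(4) by auto
  moreover from T' have "T' = Bot" unfolding v by auto
  ultimately show ?case by simp
next
  case (ctx_pair1 u u' v)
  then show ?case by (auto intro: lt_pair)
next
  case (ctx_pair2 v v' u)
  then show ?case by (auto intro: lt_pair)
next
  case (ctx_inj1 t t')
  then show ?case by (auto intro: lt_inj1)
next
  case (ctx_inj2 t t')
  then show ?case by (auto intro: lt_inj2)
next
  case (ctx_lam t t')
  then show ?case by (auto intro: lt_lam)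
next
  case (ctx_star1 u u' v)
  then show ?case by (auto intro: lt_star)
next
  case (ctx_star2 v v' u)
  then show ?case by (auto intro: lt_star)
qed

section \<open>The encoding preserves typing\<close>

lemma ltyping_proj1:
  assumes "ltyping G t (MType (Conj A B))"
  shows "ltyping G (proj1 t) (MType A)"
  unfolding proj1_def using assms
  by (intro lt_lam_neg lt_star_neg[where A = "Conj A B"])
    (auto intro!: lt_inj1 lt_var)

lemma ltyping_proj2:
  assumes "ltyping G t (MType (Conj A B))"
  shows "ltyping G (proj2 t) (MType B)"
  unfolding proj2_def using assms
  by (intro lt_lam_neg lt_star_neg[where A = "Conj A B"])
    (auto intro!: lt_inj2 lt_var)

lemma ltyping_app:
  assumes "ltyping G u (MType (Disj (neg A) B))" "ltyping G v (MType A)"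
  shows "ltyping G (app u v) (MType B)"
  unfolding app_def using assms
  by (intro lt_lam_neg lt_star_neg[where A = "Disj (neg A) B"])
    (auto intro!: lt_pair lt_var)

lemma psi_typing:
  fixes G :: "nat \<rightharpoonup> 'a mty"
  assumes "ctyping G U T"
  shows "ltyping (map_option MType \<circ> G) (psi U) T"
  using assms
proof (induction rule: ctyping.induct)
  case (ct_var G x A)
  then show ?case by (auto intro: lt_var)
next
  case (ct_K G A B)
  show ?case unfolding psi.simps
    by (rule lt_lam_neg, rule lt_star_neg[where A = A])
      (auto intro!: ltyping_proj1 ltyping_proj2 lt_var)
next
  case (ct_S G A B C)
  let ?H = "case_nat (Some (MType (neg (Disj (Conj A (Conj B (neg C)))
    (Disj (Conj A (neg B)) (Disj (neg A) C)))))) (map_option MType \<circ> G)"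
  have x: "ltyping ?H (Var 0) (MType (Conj (Disj (neg A) (Disj (neg B) C))
    (Conj (Disj (neg A) B) (Conj A (neg C)))))"
    by (auto intro: lt_var)
  note p1 = ltyping_proj1[OF x]
  note p2 = ltyping_proj1[OF ltyping_proj2[OF x]]
  note p3 = ltyping_proj1[OF ltyping_proj2[OF ltyping_proj2[OF x]]]
  note p4 = ltyping_proj2[OF ltyping_proj2[OF ltyping_proj2[OF x]]]
  show ?case unfolding psi.simps
    by (rule lt_lam_neg,
      rule lt_star_neg[OF ltyping_app[OF ltyping_app[OF p1 p3] ltyping_app[OF p2 p3]] p4])
next
  case (ct_C G A B)
  let ?H = "case_nat (Some (MType (neg (Disj (Conj A B)
    (Disj (Conj A (neg B)) (neg A)))))) (map_option MType \<circ> G)"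
  have x: "ltyping ?H (Var 0) (MType (Conj (Disj (neg A) (neg B)) (Conj (Disj (neg A) B) A)))"
    by (auto intro: lt_var)
  note p1 = ltyping_proj1[OF x]
  note p2 = ltyping_proj1[OF ltyping_proj2[OF x]]
  note p3 = ltyping_proj2[OF ltyping_proj2[OF x]]
  show ?case unfolding psi.simps
    by (rule lt_lam_neg, rule lt_star[OF ltyping_app[OF p1 p3] ltyping_app[OF p2 p3]])
next
  case (ct_P G A B)
  show ?case unfolding psi.simps
    by (rule lt_lam_neg, rule lt_star_neg[where A = "Conj A B"])
      (auto intro!: lt_pair ltyping_proj1 ltyping_proj2 lt_var)
next
  case (ct_Q1 G A B)
  show ?case unfolding psi.simps
    by (rule lt_lam_neg, rule lt_star_neg[where A = "Disj A B"])
      (auto intro!: lt_inj1 ltyping_proj1 ltyping_proj2 lt_var)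
next
  case (ct_Q2 G B A)
  show ?case unfolding psi.simps
    by (rule lt_lam_neg, rule lt_star_neg[where A = "Disj A B"])
      (auto intro!: lt_inj2 ltyping_proj1 ltyping_proj2 lt_var)
next
  case (ct_app G U A B V)
  then show ?case by (auto intro: ltyping_app)
next
  case (ct_star G U A V)
  then show ?case by (auto intro: lt_star)
qed

section \<open>Reduction sequences\<close>

text \<open>Reduction under \<open>app\<close>, \<open>proj1\<close> and \<open>proj2\<close> happens below a binder, hence on lifted terms. In the
  case of \<open>triv\<close>, the recorded environment is renumbered along with the terms, leaving the new index
  undeclared.\<close>

lemma lstep_lift:
  assumes "lstep ty t t'"
  shows "lstep ty (lift t k) (lift t' k)"
  using assms
proof (induction arbitrary: k rule: lstep.induct)
  case (beta u v)
  show ?case by (simp add: lift_subst_le lstep.beta)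
next
  case (beta_sym v u)
  show ?case by (simp add: lift_subst_le lstep.beta_sym)
next
  case (eta u)
  show ?case by (simp add: lift_lift lstep.eta)
next
  case (eta_sym u)
  show ?case by (simp add: lift_lift lstep.eta_sym)
next
  case (triv G u v)
  have "menv (insert_env k None G)"
    using triv.hyps(1) by (rule menv_insert_None)
  moreover have "ltyping (case_nat (Some Bot) (insert_env k None G)) (lift u (Suc k)) Bot"
    using triv.hyps(2) by simp
  moreover have "ltyping (insert_env k None G) (lift v k) Bot"
    using triv.hyps(3) by simp
  moreover have "occ 0 (lift u (Suc k)) = 1"
    using triv.hyps(4) by (simp add: occ_lift_less)
  moreover have "lift u (Suc k) \<noteq> Var 0"
    using triv.hyps(5) by simp
  ultimately show ?case
    by (simp add: lift_subst_le lstep.triv)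
qed (auto intro: lstep.intros)

abbreviation lsteps :: "'a itself \<Rightarrow> lexp \<Rightarrow> lexp \<Rightarrow> bool" where
  "lsteps ty \<equiv> (lstep ty)\<^sup>+\<^sup>+"

lemma tranclp_map:
  assumes "r\<^sup>+\<^sup>+ x y" and "\<And>x y. r x y \<Longrightarrow> s (f x) (f y)"
  shows "s\<^sup>+\<^sup>+ (f x) (f y)"
  using assms(1) by induction (auto intro: assms(2) tranclp.intros)

lemma lsteps_Lam: "lsteps ty t t' \<Longrightarrow> lsteps ty (Lam t) (Lam t')"
  by (erule tranclp_map[where f = Lam]) (rule ctx_lam)

lemma lsteps_Star1: "lsteps ty u u' \<Longrightarrow> lsteps ty (Star u v) (Star u' v)"
  by (erule tranclp_map[where f = "\<lambda>u. Star u v"]) (rule ctx_star1)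

lemma lsteps_Star2: "lsteps ty v v' \<Longrightarrow> lsteps ty (Star u v) (Star u v')"
  by (erule tranclp_map[where f = "Star u"]) (rule ctx_star2)

lemma lsteps_Star:
  "lsteps ty u u' \<Longrightarrow> lsteps ty v v' \<Longrightarrow> lsteps ty (Star u v) (Star u' v')"
  by (blast intro: tranclp_trans lsteps_Star1 lsteps_Star2)

lemma lsteps_Pair:
  assumes "lsteps ty u u'" "lsteps ty v v'"
  shows "lsteps ty (Pair u v) (Pair u' v')"
proof (rule tranclp_trans)
  show "lsteps ty (Pair u v) (Pair u' v)"
    using assms(1) by (rule tranclp_map[where f = "\<lambda>u. Pair u v"]) (rule ctx_pair1)
  show "lsteps ty (Pair u' v) (Pair u' v')"
    using assms(2) by (rule tranclp_map[where f = "Pair u'"]) (rule ctx_pair2)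
qed

lemma lsteps_Inj1: "lsteps ty t t' \<Longrightarrow> lsteps ty (Inj1 t) (Inj1 t')"
  by (erule tranclp_map[where f = Inj1]) (rule ctx_inj1)

lemma lsteps_Inj2: "lsteps ty t t' \<Longrightarrow> lsteps ty (Inj2 t) (Inj2 t')"
  by (erule tranclp_map[where f = Inj2]) (rule ctx_inj2)

lemma lsteps_proj1: "lsteps ty t t' \<Longrightarrow> lsteps ty (proj1 t) (proj1 t')"
  by (erule tranclp_map[where f = proj1]) (auto simp: proj1_def intro: ctx_lam ctx_star1 lstep_lift)

lemma lsteps_proj2: "lsteps ty t t' \<Longrightarrow> lsteps ty (proj2 t) (proj2 t')"
  by (erule tranclp_map[where f = proj2]) (auto simp: proj2_def intro: ctx_lam ctx_star1 lstep_lift)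

lemma lsteps_app1: "lsteps ty u u' \<Longrightarrow> lsteps ty (app u v) (app u' v)"
  by (erule tranclp_map[where f = "\<lambda>u. app u v"])
    (auto simp: app_def intro: ctx_lam ctx_star1 lstep_lift)

lemma lsteps_app2: "lsteps ty v v' \<Longrightarrow> lsteps ty (app u v) (app u v')"
  by (erule tranclp_map[where f = "app u"])
    (auto simp: app_def intro: ctx_lam ctx_star2 ctx_pair1 lstep_lift)

lemma lsteps_app:
  "lsteps ty u u' \<Longrightarrow> lsteps ty v v' \<Longrightarrow> lsteps ty (app u v) (app u' v')"
  by (blast intro: tranclp_trans lsteps_app1 lsteps_app2)

lemma lsteps_eta: "lsteps ty (Lam (Star (lift u 0) (Var 0))) u"
  by (rule tranclp.r_into_trancl) (rule eta)

lemma lsteps_eta_sym: "lsteps ty (Lam (Star (Var 0) (lift u 0))) u"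
  by (rule tranclp.r_into_trancl) (rule eta_sym)

section \<open>Combinators acting on a stack of arguments\<close>

lemma proj1_Pair: "lsteps ty (proj1 (Pair u v)) u"
proof (rule tranclp_trans)
  show "lsteps ty (proj1 (Pair u v)) (Lam (Star (lift u 0) (Var 0)))"
    by (auto simp: proj1_def intro: ctx_lam pair_inj1)
qed (rule lsteps_eta)

lemma proj2_Pair: "lsteps ty (proj2 (Pair u v)) v"
proof (rule tranclp_trans)
  show "lsteps ty (proj2 (Pair u v)) (Lam (Star (lift v 0) (Var 0)))"
    by (auto simp: proj2_def intro: ctx_lam pair_inj2)
qed (rule lsteps_eta)

lemma proj12_Pair: "lsteps ty (proj1 (proj2 (Pair u (Pair v w)))) v"
  using lsteps_proj1[OF proj2_Pair] proj1_Pair by (rule tranclp_trans)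

lemma proj22_Pair: "lsteps ty (proj2 (proj2 (Pair u (Pair v w)))) w"
  using lsteps_proj2[OF proj2_Pair] proj2_Pair by (rule tranclp_trans)

lemma proj122_Pair: "lsteps ty (proj1 (proj2 (proj2 (Pair u (Pair v (Pair w x)))))) w"
  using lsteps_proj1[OF proj22_Pair] proj1_Pair by (rule tranclp_trans)

lemma proj222_Pair: "lsteps ty (proj2 (proj2 (proj2 (Pair u (Pair v (Pair w x)))))) x"
  using lsteps_proj2[OF proj22_Pair] proj2_Pair by (rule tranclp_trans)

lemma lsteps_beta: "subst t v 0 = s \<Longrightarrow> lsteps ty (Star (Lam t) v) s"
  using beta by blast

lemma K_stack: "lsteps ty (Star (psi CK) (Pair u (Pair v w))) (Star u w)"
proof (rule tranclp_trans)
  let ?p = "Pair u (Pair v w)"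
  show "lsteps ty (Star (psi CK) ?p) (Star (proj1 ?p) (proj2 (proj2 ?p)))"
    unfolding psi.simps by (rule lsteps_beta) simp
qed (intro lsteps_Star proj1_Pair proj22_Pair)

lemma S_stack:
  "lsteps ty (Star (psi CS) (Pair u (Pair v (Pair w x)))) (Star (app (app u w) (app v w)) x)"
proof (rule tranclp_trans)
  let ?p = "Pair u (Pair v (Pair w x))"
  show "lsteps ty (Star (psi CS) ?p)
    (Star (app (app (proj1 ?p) (proj1 (proj2 (proj2 ?p))))
      (app (proj1 (proj2 ?p)) (proj1 (proj2 (proj2 ?p))))) (proj2 (proj2 (proj2 ?p))))"
    unfolding psi.simps by (rule lsteps_beta) simp
qed (intro lsteps_Star lsteps_app proj1_Pair proj12_Pair proj122_Pair proj222_Pair)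

lemma C_stack:
  "lsteps ty (Star (psi CC) (Pair u (Pair v w))) (Star (app u w) (app v w))"
proof (rule tranclp_trans)
  let ?p = "Pair u (Pair v w)"
  show "lsteps ty (Star (psi CC) ?p)
    (Star (app (proj1 ?p) (proj2 (proj2 ?p))) (app (proj1 (proj2 ?p)) (proj2 (proj2 ?p))))"
    unfolding psi.simps by (rule lsteps_beta) simp
qed (intro lsteps_Star lsteps_app proj1_Pair proj12_Pair proj22_Pair)

lemma P_stack: "lsteps ty (Star (psi CP) (Pair u (Pair v w))) (Star (Pair u v) w)"
proof (rule tranclp_trans)
  let ?p = "Pair u (Pair v w)"
  show "lsteps ty (Star (psi CP) ?p)
    (Star (Pair (proj1 ?p) (proj1 (proj2 ?p))) (proj2 (proj2 ?p)))"
    unfolding psi.simps by (rule lsteps_beta) simp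
qed (intro lsteps_Star lsteps_Pair proj1_Pair proj12_Pair proj22_Pair)

lemma Q1_stack: "lsteps ty (Star (psi CQ1) (Pair u v)) (Star (Inj1 u) v)"
proof (rule tranclp_trans)
  let ?p = "Pair u v"
  show "lsteps ty (Star (psi CQ1) ?p) (Star (Inj1 (proj1 ?p)) (proj2 ?p))"
    unfolding psi.simps by (rule lsteps_beta) simp
qed (intro lsteps_Star lsteps_Inj1 proj1_Pair proj2_Pair)

lemma Q2_stack: "lsteps ty (Star (psi CQ2) (Pair u v)) (Star (Inj2 u) v)"
proof (rule tranclp_trans)
  let ?p = "Pair u v"
  show "lsteps ty (Star (psi CQ2) ?p) (Star (Inj2 (proj1 ?p)) (proj2 ?p))"
    unfolding psi.simps by (rule lsteps_beta) simp
qed (intro lsteps_Star lsteps_Inj2 proj1_Pair proj2_Pair)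

section \<open>Combinators as functions\<close>

lemma app_Star: "lsteps ty (Star (app u v) w) (Star u (Pair v w))"
  unfolding app_def by (rule lsteps_beta) simp

lemma Star_app: "lsteps ty (Star w (app u v)) (Star u (Pair v w))"
  using beta_sym[of ty w "Star (lift u 0) (Pair (lift v 0) (Var 0))"]
  by (auto simp: app_def)

lemma app_app_Star: "lsteps ty (Star (app (app u v) w) x) (Star u (Pair v (Pair w x)))"
  using app_Star app_Star by (rule tranclp_trans)

lemma Star_app_app: "lsteps ty (Star x (app (app u v) w)) (Star u (Pair v (Pair w x)))"
  using Star_app app_Star by (rule tranclp_trans)

text \<open>The stack bottoms out in the variable bound by the outermost abstraction of \<open>app\<close>.\<close>

lemma app_app_stack:
  "lsteps ty (app (app u v) w) (Lam (Star (lift u 0) (Pair (lift v 0) (Pair (lift w 0) (Var 0)))))"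
  using app_Star[of ty "lift u 0" "lift v 0" "Pair (lift w 0) (Var 0)"]
  by (subst app_def) (simp add: lsteps_Lam)

lemma app_app_app_stack:
  "lsteps ty (app (app (app u v) w) x) (Lam (Star (lift u 0)
     (Pair (lift v 0) (Pair (lift w 0) (Pair (lift x 0) (Var 0))))))"
  using app_app_Star[of ty "lift u 0" "lift v 0" "lift w 0" "Pair (lift x 0) (Var 0)"]
  by (subst app_def) (simp add: lsteps_Lam)

lemma lift_psi_const [simp]:
  "lift (psi CK) k = psi CK" "lift (psi CS) k = psi CS" "lift (psi CC) k = psi CC"
  "lift (psi CP) k = psi CP" "lift (psi CQ1) k = psi CQ1" "lift (psi CQ2) k = psi CQ2"
  by simp_all

lemma K_app: "lsteps ty (app (app (psi CK) u) v) u"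
proof -
  have "lsteps ty (app (app (psi CK) u) v)
      (Lam (Star (psi CK) (Pair (lift u 0) (Pair (lift v 0) (Var 0)))))"
    using app_app_stack[of ty "psi CK" u v] by (simp del: psi.simps)
  also have "lsteps ty \<dots> (Lam (Star (lift u 0) (Var 0)))"
    by (intro lsteps_Lam K_stack)
  also have "lsteps ty \<dots> u" by (rule lsteps_eta)
  finally show ?thesis .
qed

lemma S_app: "lsteps ty (app (app (app (psi CS) u) v) w) (app (app u w) (app v w))"
proof -
  have "lsteps ty (app (app (app (psi CS) u) v) w)
      (Lam (Star (psi CS) (Pair (lift u 0) (Pair (lift v 0) (Pair (lift w 0) (Var 0))))))"
    using app_app_app_stack[of ty "psi CS" u v w] by (simp del: psi.simps)
  also have "lsteps ty \<dots> (Lam (Star (lift (app (app u w) (app v w)) 0) (Var 0)))"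
    unfolding lift_app by (intro lsteps_Lam S_stack)
  also have "lsteps ty \<dots> (app (app u w) (app v w))" by (rule lsteps_eta)
  finally show ?thesis .
qed

lemma C_app:
  "lsteps ty (app (app (psi CC) u) v)
     (Lam (Star (app (lift u 0) (Var 0)) (app (lift v 0) (Var 0))))"
proof -
  have "lsteps ty (app (app (psi CC) u) v)
      (Lam (Star (psi CC) (Pair (lift u 0) (Pair (lift v 0) (Var 0)))))"
    using app_app_stack[of ty "psi CC" u v] by (simp del: psi.simps)
  also have "lsteps ty \<dots> (Lam (Star (app (lift u 0) (Var 0)) (app (lift v 0) (Var 0))))"
    by (intro lsteps_Lam C_stack)
  finally show ?thesis .
qed

lemma lift_psi_CI [simp]: "lift (psi CI) k = psi CI"
  by (simp add: CI_def del: psi.simps(2,3))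

lemma I_app: "lsteps ty (app (psi CI) u) u"
  using S_app K_app unfolding CI_def psi.simps(8) by (rule tranclp_trans)

lemma C_app_K_I: "lsteps ty (app (app (psi CC) (app (psi CK) u)) (psi CI)) u"
proof -
  have "lsteps ty (app (app (psi CC) (app (psi CK) u)) (psi CI))
      (Lam (Star (app (app (psi CK) (lift u 0)) (Var 0)) (app (psi CI) (Var 0))))"
    using C_app[of ty "app (psi CK) u" "psi CI"] by (simp del: psi.simps)
  also have "lsteps ty \<dots> (Lam (Star (lift u 0) (Var 0)))"
    by (intro lsteps_Lam lsteps_Star K_app I_app)
  also have "lsteps ty \<dots> u" by (rule lsteps_eta)
  finally show ?thesis .
qed

lemma C_app_I_K: "lsteps ty (app (app (psi CC) (psi CI)) (app (psi CK) u)) u"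
proof -
  have "lsteps ty (app (app (psi CC) (psi CI)) (app (psi CK) u))
      (Lam (Star (app (psi CI) (Var 0)) (app (app (psi CK) (lift u 0)) (Var 0))))"
    using C_app[of ty "psi CI" "app (psi CK) u"] by (simp del: psi.simps)
  also have "lsteps ty \<dots> (Lam (Star (Var 0) (lift u 0)))"
    by (intro lsteps_Lam lsteps_Star K_app I_app)
  also have "lsteps ty \<dots> u" by (rule lsteps_eta_sym)
  finally show ?thesis .
qed

lemma vacuous_abs:
  "lsteps ty (app (app (psi CC) (app (psi CK) u)) (app (psi CK) v)) (Lam (lift (Star u v) 0))"
proof -
  have "lsteps ty (app (app (psi CC) (app (psi CK) u)) (app (psi CK) v))
      (Lam (Star (app (app (psi CK) (lift u 0)) (Var 0)) (app (app (psi CK) (lift v 0)) (Var 0))))"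
    using C_app[of ty "app (psi CK) u" "app (psi CK) v"] by (simp del: psi.simps)
  also have "lsteps ty \<dots> (Lam (lift (Star u v) 0))"
    unfolding lift.simps by (intro lsteps_Lam lsteps_Star K_app)
  finally show ?thesis .
qed

lemma Q1_app: "lsteps ty (app (psi CQ1) u) (Inj1 u)"
proof -
  have "app (psi CQ1) u = Lam (Star (psi CQ1) (Pair (lift u 0) (Var 0)))"
    by (simp add: app_def del: psi.simps)
  also have "lsteps ty \<dots> (Lam (Star (lift (Inj1 u) 0) (Var 0)))"
    unfolding lift.simps by (intro lsteps_Lam Q1_stack)
  also have "lsteps ty \<dots> (Inj1 u)" by (rule lsteps_eta)
  finally show ?thesis .
qed

lemma Q2_app: "lsteps ty (app (psi CQ2) u) (Inj2 u)"
proof -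
  have "app (psi CQ2) u = Lam (Star (psi CQ2) (Pair (lift u 0) (Var 0)))"
    by (simp add: app_def del: psi.simps)
  also have "lsteps ty \<dots> (Lam (Star (lift (Inj2 u) 0) (Var 0)))"
    unfolding lift.simps by (intro lsteps_Lam Q2_stack)
  also have "lsteps ty \<dots> (Inj2 u)" by (rule lsteps_eta)
  finally show ?thesis .
qed

text \<open>A pairing term has to become a pair on its own, by \<open>eta\<close>. Contracting its interaction with an
  injection directly would always put the pair on the left, whereas the rules for \<open>Q1\<close> and \<open>Q2\<close>
  distinguish the two orders.\<close>

lemma P_app: "lsteps ty (app (app (psi CP) u) v) (Pair u v)"
proof -
  have "lsteps ty (app (app (psi CP) u) v)
      (Lam (Star (psi CP) (Pair (lift u 0) (Pair (lift v 0) (Var 0)))))"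
    using app_app_stack[of ty "psi CP" u v] by (simp del: psi.simps)
  also have "lsteps ty \<dots> (Lam (Star (lift (Pair u v) 0) (Var 0)))"
    unfolding lift.simps by (intro lsteps_Lam P_stack)
  also have "lsteps ty \<dots> (Pair u v)" by (rule lsteps_eta)
  finally show ?thesis .
qed

section \<open>Simulation\<close>

inductive_cases ct_AppE: "ctyping G (CApp U V) T"
inductive_cases ct_StarE: "ctyping G (CStar U V) T"

text \<open>Typability of \<open>Star u v\<close> in the environment of the redex is read off from the typing of the
  vacuous abstraction to which the redex reduces.\<close>

lemma ltyping_vacuous_abs:
  assumes "ltyping G (app (app (psi CC) (app (psi CK) u)) (app (psi CK) v)) T"
  obtains A where "T = MType A" "ltyping G (Star u v) Bot"
proof -
  have "ltyping G t' T" if "lsteps ty t t'" "ltyping G t T" for ty :: "'z itself" and t t'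
    using that by induction (auto intro: subject_reduction)
  from this[OF vacuous_abs assms] that show thesis
    by (auto simp del: lift.simps)
qed

text \<open>One occurrence of the variable \<open>x\<close> is singled out and its copy of \<open>C (K U) (K V)\<close> reduced to a
  vacuous abstraction; \<open>u\<close> is the result with index 0 as placeholder for the body. All other copies
  remain part of \<open>u\<close>, which makes the placeholder occur exactly once. The base case \<open>Lam (Var 1)\<close>
  admits every type because it abstracts over an arbitrary type and refers past its own binder to
  the placeholder.\<close>

lemma isolate_copy:
  fixes G :: "nat \<rightharpoonup> 'a mty"
  defines "H \<equiv> case_nat (Some Bot) (map_option MType \<circ> G)"
  assumes "x \<in> cvars W"
    and "ctyping G (csubst W x (CApp (CApp CC (CApp CK U)) (CApp CK V))) T"
  shows "ltyping (map_option MType \<circ> G) (Star (psi U) (psi V)) Bot \<and>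
    (\<exists>u. ltyping H u T \<and> occ 0 u = 1 \<and> u \<noteq> Var 0 \<and>
      lsteps ty (psi (csubst W x (CApp (CApp CC (CApp CK U)) (CApp CK V))))
        (subst u (Star (psi U) (psi V)) 0))"
  using assms(2,3)
proof (induction W arbitrary: T)
  case (CVar y)
  let ?Z = "CApp (CApp CC (CApp CK U)) (CApp CK V)"
  from CVar have "ctyping G ?Z T" by simp
  then have "ltyping (map_option MType \<circ> G) (psi ?Z) T" by (rule psi_typing)
  then obtain A where A: "T = MType A"
      and uv: "ltyping (map_option MType \<circ> G) (Star (psi U) (psi V)) Bot"
    unfolding psi.simps(8) by (rule ltyping_vacuous_abs)
  have "ltyping H (Lam (Var 1)) T"
    unfolding A by (rule lt_lam_neg) (auto simp: H_def intro: lt_var)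
  moreover have "lsteps ty (psi ?Z) (subst (Lam (Var 1)) (Star (psi U) (psi V)) 0)"
    using vacuous_abs[of ty "psi U" "psi V"] by (simp del: psi.simps(2-7))
  ultimately show ?case
    using CVar.prems(1) by (intro conjI uv exI[of _ "Lam (Var 1)"]) simp_all
next
  case (CApp W1 W2)
  let ?Z = "CApp (CApp CC (CApp CK U)) (CApp CK V)" and ?s = "Star (psi U) (psi V)"
  from CApp.prems(2) obtain A B where T: "T = MType B"
      and 1: "ctyping G (csubst W1 x ?Z) (MType (Disj (neg A) B))"
      and 2: "ctyping G (csubst W2 x ?Z) (MType A)"
    by (auto elim: ct_AppE)
  show ?case
  proof (cases "x \<in> cvars W1")
    case True
    from CApp.IH(1)[OF True 1] obtain u where uv: "ltyping (map_option MType \<circ> G) ?s Bot"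
      and u: "ltyping H u (MType (Disj (neg A) B))" "occ 0 u = 1"
        "lsteps ty (psi (csubst W1 x ?Z)) (subst u ?s 0)"
      by (elim conjE exE) (rule that)
    have "ltyping H (app u (lift (psi (csubst W2 x ?Z)) 0)) T"
      unfolding T using u(1) psi_typing[OF 2] by (auto simp: H_def intro: ltyping_app)
    with u(2,3) show ?thesis
      by (intro conjI uv exI[of _ "app u (lift (psi (csubst W2 x ?Z)) 0)"])
        (simp_all add: lsteps_app1 del: psi.simps(2-7))
  next
    case False
    with CApp.prems(1) have "x \<in> cvars W2" by simp
    from CApp.IH(2)[OF this 2] obtain u where uv: "ltyping (map_option MType \<circ> G) ?s Bot"
      and u: "ltyping H u (MType A)" "occ 0 u = 1"
        "lsteps ty (psi (csubst W2 x ?Z)) (subst u ?s 0)"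
      by (elim conjE exE) (rule that)
    have "ltyping H (app (lift (psi (csubst W1 x ?Z)) 0) u) T"
      unfolding T using u(1) psi_typing[OF 1] by (auto simp: H_def intro: ltyping_app)
    with u(2,3) show ?thesis
      by (intro conjI uv exI[of _ "app (lift (psi (csubst W1 x ?Z)) 0) u"])
        (simp_all add: lsteps_app2)
  qed
next
  case (CStar W1 W2)
  let ?Z = "CApp (CApp CC (CApp CK U)) (CApp CK V)" and ?s = "Star (psi U) (psi V)"
  from CStar.prems(2) obtain A where T: "T = Bot"
      and 1: "ctyping G (csubst W1 x ?Z) (MType (neg A))"
      and 2: "ctyping G (csubst W2 x ?Z) (MType A)"
    by (auto elim: ct_StarE)
  show ?case
  proof (cases "x \<in> cvars W1")
    case True
    from CStar.IH(1)[OF True 1] obtain u where uv: "ltyping (map_option MType \<circ> G) ?s Bot"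
      and u: "ltyping H u (MType (neg A))" "occ 0 u = 1"
        "lsteps ty (psi (csubst W1 x ?Z)) (subst u ?s 0)"
      by (elim conjE exE) (rule that)
    have "ltyping H (Star u (lift (psi (csubst W2 x ?Z)) 0)) T"
      unfolding T using u(1) psi_typing[OF 2] by (auto simp: H_def intro: lt_star)
    with u(2,3) show ?thesis
      by (intro conjI uv exI[of _ "Star u (lift (psi (csubst W2 x ?Z)) 0)"])
        (simp_all add: lsteps_Star1)
  next
    case False
    with CStar.prems(1) have "x \<in> cvars W2" by simp
    from CStar.IH(2)[OF this 2] obtain u where uv: "ltyping (map_option MType \<circ> G) ?s Bot"
      and u: "ltyping H u (MType A)" "occ 0 u = 1"
        "lsteps ty (psi (csubst W2 x ?Z)) (subst u ?s 0)"
      by (elim conjE exE) (rule that)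
    have "ltyping H (Star (lift (psi (csubst W1 x ?Z)) 0) u) T"
      unfolding T using u(1) psi_typing[OF 1] by (auto simp: H_def intro: lt_star)
    with u(2,3) show ?thesis
      by (intro conjI uv exI[of _ "Star (lift (psi (csubst W1 x ?Z)) 0) u"])
        (simp_all add: lsteps_Star2)
  qed
qed simp_all

lemma menv_map_MType: "menv (map_option MType \<circ> G)"
  by (auto simp: menv_def ran_def)

text \<open>The erasure performed by \<open>triv\<close> demands a typed placeholder context, which has to be found in the
  typing of the redex of \<open>simp\<close>. Since CCL has no binders, one environment types all subterms, so it
  can stay fixed in the induction.\<close>

lemma simulation:
  fixes G :: "nat \<rightharpoonup> 'a mty"
  assumes "cstep TYPE('a) U V" "ctyping G U T"
  shows "lsteps TYPE('a) (psi U) (psi V)"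
  using assms
proof (induction arbitrary: T rule: cstep.induct)
  case (cs_K U V)
  show ?case unfolding psi.simps(8) by (rule K_app)
next
  case (cs_S U V W)
  show ?case unfolding psi.simps(8) by (rule S_app)
next
  case (cs_C U V W)
  show ?case unfolding psi.simps(8,9)
    using app_app_Star C_stack by (rule tranclp_trans)
next
  case (cs_C_sym W U V)
  show ?case unfolding psi.simps(8,9)
    using Star_app_app C_stack by (rule tranclp_trans)
next
  case (cs_eta U)
  show ?case unfolding psi.simps(8) by (rule C_app_K_I)
next
  case (cs_eta_sym U)
  show ?case unfolding psi.simps(8) by (rule C_app_I_K)
next
  case (cs_P_Q1 U V W)
  show ?case unfolding psi.simps(8,9)
    using lsteps_Star[OF P_app Q1_app] pair_inj1 by (rule tranclp.trancl_into_trancl)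
next
  case (cs_P_Q2 U V W)
  show ?case unfolding psi.simps(8,9)
    using lsteps_Star[OF P_app Q2_app] pair_inj2 by (rule tranclp.trancl_into_trancl)
next
  case (cs_Q1_P W U V)
  show ?case unfolding psi.simps(8,9)
    using lsteps_Star[OF Q1_app P_app] inj1_pair by (rule tranclp.trancl_into_trancl)
next
  case (cs_Q2_P W U V)
  show ?case unfolding psi.simps(8,9)
    using lsteps_Star[OF Q2_app P_app] inj2_pair by (rule tranclp.trancl_into_trancl)
next
  case (cs_simp G' W x U V)
  \<comment> \<open>The typing of \<open>W\<close> in \<open>G'\<close> only shows that \<open>W\<close> is an interaction: the type that \<open>G'\<close> gives to
    \<open>x\<close> may differ from that of the term substituted for \<open>x\<close>, so the placeholder context is
    typed through the redex in \<open>G\<close> instead.\<close>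
  from cs_simp.hyps(1) obtain W1 W2 where W: "W = CStar W1 W2"
    by cases auto
  with cs_simp.prems have "T = Bot" by (auto elim: ct_StarE)
  from isolate_copy[OF cs_simp.hyps(2) cs_simp.prems[unfolded this], of "TYPE('a)"]
  obtain u where
    uv: "ltyping (map_option MType \<circ> G) (Star (psi U) (psi V)) Bot" and
    u: "ltyping (case_nat (Some Bot) (map_option MType \<circ> G)) u Bot" "occ 0 u = 1" "u \<noteq> Var 0" and
    steps: "lsteps TYPE('a) (psi (csubst W x (CApp (CApp CC (CApp CK U)) (CApp CK V))))
      (subst u (Star (psi U) (psi V)) 0)"
    by (elim conjE exE) (rule that)
  have "lstep TYPE('a) (subst u (Star (psi U) (psi V)) 0) (Star (psi U) (psi V))"
    using menv_map_MType u(1) uv u(2,3) by (rule triv)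
  with steps show ?case
    unfolding psi.simps(9) by (rule tranclp.trancl_into_trancl)
next
  case (cs_app1 U U' V)
  then show ?case by (auto elim!: ct_AppE intro: lsteps_app1)
next
  case (cs_app2 V V' U)
  then show ?case by (auto elim!: ct_AppE intro: lsteps_app2)
next
  case (cs_star1 U U' V)
  then show ?case by (auto elim!: ct_StarE intro: lsteps_Star1)
next
  case (cs_star2 V V' U)
  then show ?case by (auto elim!: ct_StarE intro: lsteps_Star2)
qed

text \<open>By subject reduction a sequence of steps from a typable term never leaves the typable terms.\<close>

lemma lsteps_imp_lreds:
  fixes G :: "nat \<rightharpoonup> 'a ty"
  assumes "lsteps TYPE('a) t t'" "menv G" "ltyping G t T"
  shows "(lred TYPE('a))\<^sup>+\<^sup>+ t t'"
proof -
  have "(lred TYPE('a))\<^sup>+\<^sup>+ t t' \<and> ltyping G t' T"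
    using assms(1)
  proof induction
    case (base t')
    then have "ltyping G t' T" using assms(3) by (rule subject_reduction)
    with base assms(2,3) show ?case
      by (auto simp: lred_def lterm_def)
  next
    case (step t' t'')
    then have "ltyping G t'' T" by (blast intro: subject_reduction)
    with step assms(2) have "lred TYPE('a) t' t''"
      by (auto simp: lred_def lterm_def)
    with step \<open>ltyping G t'' T\<close> show ?case by auto
  qed
  then show ?thesis ..
qed

theorem theorem29:
  fixes U V :: cexp
  assumes "cterm TYPE('a) U" and "cterm TYPE('a) V"
    and "cred TYPE('a) U V"
  shows "(lred TYPE('a))\<^sup>+\<^sup>+ (psi U) (psi V)"
proof -
  from assms(1) obtain G :: "nat \<rightharpoonup> 'a mty" and T where U: "ctyping G U T"
    unfolding cterm_def by blast
  from assms(3) have "cstep TYPE('a) U V" by (simp add: cred_def)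
  then have "lsteps TYPE('a) (psi U) (psi V)" using U by (rule simulation)
  then show ?thesis using menv_map_MType psi_typing[OF U] by (rule lsteps_imp_lreds)
qed

end
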